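(* Let $\Lambda \subset \mathbb{R}^n$ be an $n$-dimensional lattice containing the origin $\mathbf{0}$, and let $P = V_{\Lambda}(\mathbf{0})$ be the Voronoi cell of $\mathbf{0}$ with respect to $\Lambda$. If $R = R(\Lambda)$ is the covering radius of $\Lambda$, then $$\int_{P} \| x \|^2 \, dx \;\geq\; \frac{R^2}{3} \cdot |P|.$$
   Context: $\|\cdot\|$ is the standard Euclidean norm on $\mathbb{R}^n$, $|X|$ is the $n$-dimensional Lebesgue measure of $X \subset \mathbb{R}^n$, and $\operatorname{dist}(x,\Lambda)$ is the Euclidean distance from the point $x$ to the set $\Lambda$. An $n$-dimensional lattice containing the origin is a discrete additive subgroup of $\mathbb{R}^n$ of full rank $n$. The covering radius of $\Lambda$ is $R(\Lambda) = \sup_{x \in \mathbb{R}^n} \operatorname{dist}(x, \Lambda)$. For $v \in \Lambda$, the Voronoi cell of $v$ with respect to $\Lambda$ is $V_{\Lambda}(v) = \{ x \in \mathbb{R}^n : \| x - v \| = \operatorname{dist}(x, \Lambda) \}$. *)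

theory Defs
  imports "HOL-Analysis.Analysis"
begin

definition full_rank_lattice :: "(real ^ 'n) set \<Rightarrow> bool" where
  "full_rank_lattice \<Lambda> \<longleftrightarrow>
     0 \<in> \<Lambda> \<and> (\<forall>x\<in>\<Lambda>. \<forall>y\<in>\<Lambda>. x + y \<in> \<Lambda>) \<and> (\<forall>x\<in>\<Lambda>. - x \<in> \<Lambda>) \<and>
     discrete \<Lambda> \<and> span \<Lambda> = UNIV"

text \<open>
  The supremum is taken in the reals; it is the genuine one for a full-rank lattice,
  since the distance to such a lattice is a bounded function.
\<close>
definition covering_radius :: "(real ^ 'n) set \<Rightarrow> real" where
  "covering_radius \<Lambda> = (SUP x. infdist x \<Lambda>)"

definition voronoi_cell :: "(real ^ 'n) set \<Rightarrow> real ^ 'n \<Rightarrow> (real ^ 'n) set" where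
  "voronoi_cell \<Lambda> v = {x. norm (x - v) = infdist x \<Lambda>}"

end

theory Submission
  imports Defs
begin

text \<open>
  Let \<open>f x = (infdist x \<Lambda>)\<^sup>2\<close>. If \<open>p\<close> and \<open>q\<close> are lattice points nearest to \<open>x\<close> and \<open>w + x\<close>,
  then the parallelogram law for \<open>x - p\<close> and \<open>w + x - q\<close> gives
  \<open>f (w + 2x) + f w \<le> 2 (f x + f (w + x))\<close>. The maps \<open>x \<mapsto> w + x\<close> and \<open>x \<mapsto> w + 2x\<close> preserve the
  mean \<open>M\<close> of a periodic function, so \<open>M + f w \<le> 4 M\<close>; now take the supremum over \<open>w\<close>.
  Since periodic means are limits of means over large balls, no lattice basis is needed for the
  invariance under doubling.
\<close>

section \<open>Integrals over almost disjoint unions, affine images and compact sets\<close>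

lemma set_integral_finite_UN_AE:
  fixes f :: "'a \<Rightarrow> 'b :: {banach, second_countable_topology}"
  assumes "finite I"
    and "\<And>i j. i \<in> I \<Longrightarrow> j \<in> I \<Longrightarrow> i \<noteq> j \<Longrightarrow> AE x in M. \<not> (x \<in> A i \<and> x \<in> A j)"
    and "\<And>i. i \<in> I \<Longrightarrow> set_integrable M (A i) f"
    and "\<And>i. i \<in> I \<Longrightarrow> A i \<in> sets M"
  shows "(LINT x:(\<Union>i\<in>I. A i)|M. f x) = (\<Sum>i\<in>I. LINT x:A i|M. f x)"
  using assms
proof (induction I)
  case (insert k I)
  have "AE x in M. \<forall>i\<in>I. \<not> (x \<in> A k \<and> x \<in> A i)"
    using insert by (intro AE_finite_allI) auto
  then have "AE x in M. \<not> (x \<in> A k \<and> x \<in> (\<Union>i\<in>I. A i))"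
    by eventually_elim auto
  moreover have "set_integrable M (\<Union>i\<in>I. A i) f"
    using insert by (intro set_integrable_UN) auto
  ultimately have "(LINT x:(A k \<union> (\<Union>i\<in>I. A i))|M. f x)
      = (LINT x:A k|M. f x) + (LINT x:(\<Union>i\<in>I. A i)|M. f x)"
    using insert.prems insert.hyps by (intro set_integral_Un_AE sets.finite_UN) auto
  then show ?case
    using insert by simp
qed (simp add: set_lebesgue_integral_def)

text \<open>Change of variables with Jacobian \<open>\<bar>c\<bar> ^ DIM('a)\<close>. The case
  \<open>c = 1\<close> moves integrals between cells and between balls; the case
  \<open>c = 2\<close> handles the doubling map \<open>x \<mapsto> w + 2x\<close>.\<close>

lemma set_lborel_integral_affine:
  fixes f :: "'a :: euclidean_space \<Rightarrow> real"
  assumes c: "c \<noteq> 0" and [measurable]: "f \<in> borel_measurable borel" "S \<in> sets borel"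
  shows "(LINT x:S|lborel. f x)
    = \<bar>c\<bar> ^ DIM('a) * (LINT x:{x. t + c *\<^sub>R x \<in> S}|lborel. f (t + c *\<^sub>R x))"
proof -
  have "(LINT x:S|lborel. f x) = (LINT x|density (distr lborel borel (\<lambda>x. t + c *\<^sub>R x))
      (\<lambda>_. \<bar>c\<bar> ^ DIM('a)). indicator S x *\<^sub>R f x)"
    unfolding set_lebesgue_integral_def using lborel_affine[OF c, of t] by simp
  also have "\<dots> = \<bar>c\<bar> ^ DIM('a) *
      (LINT x|distr lborel borel (\<lambda>x. t + c *\<^sub>R x). indicator S x *\<^sub>R f x)"
    by (subst integral_density) auto
  also have "(LINT x|distr lborel borel (\<lambda>x. t + c *\<^sub>R x). indicator S x *\<^sub>R f x)
      = (LINT x:{x. t + c *\<^sub>R x \<in> S}|lborel. f (t + c *\<^sub>R x))"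
    unfolding set_lebesgue_integral_def
    by (subst integral_distr) (auto simp: indicator_def)
  finally show ?thesis .
qed

lemma set_integrable_lborel_compact:
  fixes f :: "'a :: euclidean_space \<Rightarrow> real"
  assumes "compact S" "continuous_on UNIV f"
  shows "set_integrable lborel S f"
  unfolding set_integrable_def
  using assms(1) continuous_on_subset[OF assms(2) subset_UNIV] by (rule borel_integrable_compact)

lemma set_integral_mono_set_lborel:
  fixes f :: "'a :: euclidean_space \<Rightarrow> real"
  assumes "compact S" "compact T" "S \<subseteq> T" "continuous_on UNIV f" "\<And>x. 0 \<le> f x"
  shows "(LINT x:S|lborel. f x) \<le> (LINT x:T|lborel. f x)"
  using set_integrable_lborel_compact[OF assms(1,4)] set_integrable_lborel_compact[OF assms(2,4)] assms(3,5)
  unfolding set_lebesgue_integral_def set_integrable_def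
  by (intro integral_mono) (auto simp: indicator_def)

section \<open>Lattices: group operations, discreteness, bounded distance function\<close>

lemma lattice_zero: "full_rank_lattice \<Lambda> \<Longrightarrow> 0 \<in> \<Lambda>"
  and lattice_add: "full_rank_lattice \<Lambda> \<Longrightarrow> x \<in> \<Lambda> \<Longrightarrow> y \<in> \<Lambda> \<Longrightarrow> x + y \<in> \<Lambda>"
  and lattice_minus: "full_rank_lattice \<Lambda> \<Longrightarrow> x \<in> \<Lambda> \<Longrightarrow> - x \<in> \<Lambda>"
  by (auto simp: full_rank_lattice_def)

lemma lattice_diff: "full_rank_lattice \<Lambda> \<Longrightarrow> x \<in> \<Lambda> \<Longrightarrow> y \<in> \<Lambda> \<Longrightarrow> x - y \<in> \<Lambda>"
  using lattice_add[of \<Lambda> x "- y"] lattice_minus[of \<Lambda> y] by simp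

lemma lattice_sum:
  assumes "full_rank_lattice \<Lambda>" "\<And>i. i \<in> I \<Longrightarrow> f i \<in> \<Lambda>"
  shows "sum f I \<in> \<Lambda>"
  using assms(2) by (induction I rule: infinite_finite_induct) (auto simp: lattice_zero lattice_add assms(1))

lemma lattice_of_int_scaleR:
  assumes L: "full_rank_lattice \<Lambda>" and "x \<in> \<Lambda>"
  shows "of_int k *\<^sub>R x \<in> \<Lambda>"
proof -
  have nat: "of_nat n *\<^sub>R x \<in> \<Lambda>" for n
    by (induction n) (auto simp: scaleR_left_distrib lattice_zero[OF L] lattice_add[OF L] assms)
  show ?thesis
  proof (cases k)
    case (neg n)
    then have "of_int k = - real (Suc n)"
      by simp
    then show ?thesis
      using lattice_minus[OF L nat[of "Suc n"]] by (simp only: scaleR_minus_left of_nat_id)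
  qed (use nat in simp)
qed

text \<open>Differences of lattice points are lattice points, so a radius isolating 0 separates
  every pair. Closedness and finiteness in balls follow from this uniformity.\<close>

lemma uniform_discrete_lattice:
  assumes L: "full_rank_lattice \<Lambda>"
  shows "uniform_discrete \<Lambda>"
proof -
  have "0 isolated_in \<Lambda>"
    using L unfolding full_rank_lattice_def discrete_def by auto
  then obtain e where e: "e > 0" "\<And>y. y \<in> \<Lambda> \<Longrightarrow> dist 0 y < e \<Longrightarrow> y = 0"
    unfolding isolated_in_dist_Ex_iff by metis
  have "x = y" if "x \<in> \<Lambda>" "y \<in> \<Lambda>" "dist x y < e" for x y
    using e(2)[OF lattice_diff[OF L that(1,2)]] that(3)
    by (simp add: dist_norm norm_minus_commute)
  then show ?thesis
    unfolding uniform_discrete_def using e(1) by blast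
qed

lemma closed_lattice: "full_rank_lattice \<Lambda> \<Longrightarrow> closed \<Lambda>"
  by (simp add: uniform_discrete_imp_closed uniform_discrete_lattice)

lemma finite_lattice_Int_cball: "full_rank_lattice \<Lambda> \<Longrightarrow> finite (\<Lambda> \<inter> cball c r)"
  using uniform_discrete_subset[OF uniform_discrete_lattice Int_lower1]
  by (simp add: uniform_discrete_finite_iff[symmetric] bounded_Int)

lemma lattice_nearest_point:
  assumes "full_rank_lattice \<Lambda>"
  obtains p where "p \<in> \<Lambda>" "infdist x \<Lambda> = norm (x - p)"
  using infdist_attains_inf[OF closed_lattice[OF assms], of x] lattice_zero[OF assms]
  by (auto simp: dist_norm)

lemma infdist_le_norm_diff: "p \<in> \<Lambda> \<Longrightarrow> infdist x \<Lambda> \<le> norm (x - p)"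
  using infdist_le[of p \<Lambda> x] by (simp add: dist_norm)

lemma infdist_add_lattice:
  assumes L: "full_rank_lattice \<Lambda>" and v: "v \<in> \<Lambda>"
  shows "infdist (x + v) \<Lambda> = infdist x \<Lambda>"
proof -
  have le: "infdist (x + v) \<Lambda> \<le> infdist x \<Lambda>" if v: "v \<in> \<Lambda>" for x v
  proof -
    obtain p where p: "p \<in> \<Lambda>" "infdist x \<Lambda> = norm (x - p)"
      using lattice_nearest_point[OF L] .
    show ?thesis
      using infdist_le_norm_diff[OF lattice_add[OF L p(1) v], of "x + v"] p(2) by simp
  qed
  show ?thesis
    using le[OF v, of x] le[OF lattice_minus[OF L v], of "x + v"] by simp
qed

text \<open>A maximal independent \<open>B\<close> inside the lattice is a basis of the space,
  though perhaps not of the lattice. Rounding the coordinates of \<open>x\<close> down gives a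
  lattice point, and the remainder has coordinates in [0, 1), so its norm is at most the sum of the
  norms of \<open>B\<close>.\<close>

lemma infdist_lattice_bounded:
  assumes L: "full_rank_lattice \<Lambda>"
  obtains K where "0 \<le> K" "\<And>x. infdist x \<Lambda> \<le> K"
proof -
  obtain B where B: "B \<subseteq> \<Lambda>" "independent B" "\<Lambda> \<subseteq> span B"
    using maximal_independent_subset by blast
  have fin: "finite B"
    using B(2) by (rule independent_imp_finite)
  have "span B = UNIV"
    using B(3) L span_minimal[OF B(3) subspace_span] unfolding full_rank_lattice_def by auto
  have "infdist x \<Lambda> \<le> (\<Sum>b\<in>B. norm b)" for x
  proof -
    have "x \<in> range (\<lambda>u. \<Sum>b\<in>B. u b *\<^sub>R b)"
      using \<open>span B = UNIV\<close> span_finite[OF fin] by auto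
    then obtain u where u: "x = (\<Sum>b\<in>B. u b *\<^sub>R b)"
      by auto
    define p where "p = (\<Sum>b\<in>B. of_int \<lfloor>u b\<rfloor> *\<^sub>R b)"
    have "p \<in> \<Lambda>"
      unfolding p_def using B(1) by (intro lattice_sum[OF L] lattice_of_int_scaleR[OF L]) auto
    have "x - p = (\<Sum>b\<in>B. frac (u b) *\<^sub>R b)"
      unfolding u p_def by (simp add: sum_subtractf[symmetric] scaleR_left_diff_distrib frac_def)
    also have "norm \<dots> \<le> (\<Sum>b\<in>B. norm b)"
    proof (rule sum_norm_le)
      fix b
      show "norm (frac (u b) *\<^sub>R b) \<le> norm b"
        using frac_lt_1[of "u b"] by (simp add: mult_left_le_one_le)
    qed
    finally show ?thesis
      using infdist_le_norm_diff[OF \<open>p \<in> \<Lambda>\<close>, of x] by simp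
  qed
  then show ?thesis
    by (intro that[of "\<Sum>b\<in>B. norm b"]) (auto simp: sum_nonneg)
qed

section \<open>Voronoi cells: translation, compactness, null overlaps\<close>

lemma voronoi_cell_translate_iff:
  assumes "full_rank_lattice \<Lambda>" "v \<in> \<Lambda>"
  shows "x + v \<in> voronoi_cell \<Lambda> v \<longleftrightarrow> x \<in> voronoi_cell \<Lambda> 0"
  by (simp add: voronoi_cell_def infdist_add_lattice[OF assms])

lemma voronoi_cell_subset_cball:
  assumes "\<And>x. infdist x \<Lambda> \<le> K"
  shows "voronoi_cell \<Lambda> v \<subseteq> cball v K"
  using assms by (auto simp: voronoi_cell_def dist_norm norm_minus_commute)

lemma compact_voronoi_cell:
  assumes L: "full_rank_lattice \<Lambda>"
  shows "compact (voronoi_cell \<Lambda> v)"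
proof -
  obtain K where "\<And>x. infdist x \<Lambda> \<le> K"
    using infdist_lattice_bounded[OF L] by blast
  then have "bounded (voronoi_cell \<Lambda> v)"
    by (rule bounded_subset[OF bounded_cball voronoi_cell_subset_cball])
  moreover have "closed (voronoi_cell \<Lambda> v)"
    unfolding voronoi_cell_def by (intro closed_Collect_eq continuous_intros)
  ultimately show ?thesis
    by (simp add: compact_eq_bounded_closed)
qed

text \<open>A common point is equidistant from \<open>v\<close> and \<open>w\<close>. Expanding the
  squared norms puts it on their bisecting hyperplane \<open>?H\<close>, which is a null
  set.\<close>

lemma AE_voronoi_cells_disjoint:
  fixes v w :: "real ^ 'n"
  assumes "v \<noteq> w"
  shows "AE x in lborel. \<not> (x \<in> voronoi_cell \<Lambda> v \<and> x \<in> voronoi_cell \<Lambda> w)"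
proof -
  let ?H = "{x. (2 *\<^sub>R (v - w)) \<bullet> x = v \<bullet> v - w \<bullet> w}"
  have "negligible ?H"
    using assms by (intro negligible_hyperplane) auto
  moreover have "closed ?H"
    by (rule closed_hyperplane)
  ultimately have "?H \<in> null_sets lborel"
    by (auto simp: negligible_iff_null_sets null_sets_completion_iff)
  then have "AE x in lborel. x \<notin> ?H"
    by (rule AE_not_in)
  then show ?thesis
  proof eventually_elim
    case (elim x)
    have "x \<in> ?H" if "norm (x - v) = norm (x - w)"
    proof -
      have "(norm (x - v))\<^sup>2 = (norm (x - w))\<^sup>2"
        using that by simp
      then show ?thesis
        by (simp add: power2_norm_eq_inner inner_diff_left inner_diff_right inner_commute)
    qed
    then show ?case
      using elim by (auto simp: voronoi_cell_def)
  qed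
qed

section \<open>Integrals of periodic functions over cells and balls\<close>

lemma set_integral_voronoi_cells:
  fixes g :: "real ^ 'n \<Rightarrow> real"
  assumes L: "full_rank_lattice \<Lambda>" and g: "continuous_on UNIV g"
    and per: "\<And>x v. v \<in> \<Lambda> \<Longrightarrow> g (x + v) = g x"
    and S: "finite S" "S \<subseteq> \<Lambda>"
  shows "(LINT x:(\<Union>v\<in>S. voronoi_cell \<Lambda> v)|lborel. g x)
    = card S * (LINT x:voronoi_cell \<Lambda> 0|lborel. g x)"
proof -
  have [measurable]: "g \<in> borel_measurable borel"
    using g by (rule borel_measurable_continuous_onI)
  have meas [measurable]: "voronoi_cell \<Lambda> v \<in> sets borel" for v
    using compact_imp_closed[OF compact_voronoi_cell[OF L]] by (rule borel_closed)
  \<comment> \<open>The cell of \<open>v\<close> is the cell of 0 shifted by \<open>v\<close>, and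
    \<open>g\<close> is unchanged by that shift.\<close>
  have cell: "(LINT x:voronoi_cell \<Lambda> v|lborel. g x) = (LINT x:voronoi_cell \<Lambda> 0|lborel. g x)"
    if "v \<in> \<Lambda>" for v
    using set_lborel_integral_affine[of 1 g "voronoi_cell \<Lambda> v" v]
      per[OF that] voronoi_cell_translate_iff[OF L that]
    by (simp add: add.commute[of v])
  have "(LINT x:(\<Union>v\<in>S. voronoi_cell \<Lambda> v)|lborel. g x)
      = (\<Sum>v\<in>S. LINT x:voronoi_cell \<Lambda> v|lborel. g x)"
    using S(1)
    by (intro set_integral_finite_UN_AE AE_voronoi_cells_disjoint
        set_integrable_lborel_compact[OF compact_voronoi_cell[OF L] g]) auto
  also have "\<dots> = (\<Sum>v\<in>S. LINT x:voronoi_cell \<Lambda> 0|lborel. g x)"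
    using S(2) by (intro sum.cong refl cell) auto
  finally show ?thesis
    by simp
qed

text \<open>The cells centred in the ball of radius \<open>r\<close> almost tile it. A point within
  \<open>r - K\<close> of \<open>c\<close> has its nearest lattice point within \<open>r\<close> of
  \<open>c\<close>, and each cell stays within \<open>K\<close> of its centre. The union of these
  cells thus lies between two balls.\<close>

lemma set_integral_cball_voronoi_bounds:
  fixes g :: "real ^ 'n \<Rightarrow> real"
  assumes L: "full_rank_lattice \<Lambda>" and K: "\<And>x. infdist x \<Lambda> \<le> K"
    and g: "continuous_on UNIV g" "\<And>x. 0 \<le> g x" "\<And>x v. v \<in> \<Lambda> \<Longrightarrow> g (x + v) = g x"
  shows "(LINT x:cball c (r - K)|lborel. g x)
      \<le> card (\<Lambda> \<inter> cball c r) * (LINT x:voronoi_cell \<Lambda> 0|lborel. g x)" (is ?upper)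
    and "card (\<Lambda> \<inter> cball c r) * (LINT x:voronoi_cell \<Lambda> 0|lborel. g x)
      \<le> (LINT x:cball c (r + K)|lborel. g x)" (is ?lower)
proof -
  let ?S = "\<Lambda> \<inter> cball c r" and ?U = "\<Union>v\<in>\<Lambda> \<inter> cball c r. voronoi_cell \<Lambda> v"
  have fin: "finite ?S"
    using L by (rule finite_lattice_Int_cball)
  have compact: "compact ?U"
    using fin compact_voronoi_cell[OF L] by (intro compact_UN) auto
  have eq: "(LINT x:?U|lborel. g x) = card ?S * (LINT x:voronoi_cell \<Lambda> 0|lborel. g x)"
    using fin by (intro set_integral_voronoi_cells[OF L g(1,3)]) auto
  have "cball c (r - K) \<subseteq> ?U"
  proof
    fix x assume x: "x \<in> cball c (r - K)"
    obtain p where p: "p \<in> \<Lambda>" "infdist x \<Lambda> = norm (x - p)"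
      using lattice_nearest_point[OF L] .
    have "dist c p \<le> dist c x + norm (x - p)"
      using dist_triangle[of c p x] by (simp add: dist_norm)
    then have "p \<in> ?S"
      using p x K[of x] by simp
    then show "x \<in> ?U"
      using p(2) by (auto simp: voronoi_cell_def)
  qed
  then show ?upper
    using set_integral_mono_set_lborel[OF compact_cball compact _ g(1,2)] eq by simp
  have "?U \<subseteq> cball c (r + K)"
  proof
    fix x assume "x \<in> ?U"
    then obtain v where "dist c v \<le> r" "x \<in> cball v K"
      using voronoi_cell_subset_cball[OF K] by force
    then show "x \<in> cball c (r + K)"
      using dist_triangle[of c x v] by simp
  qed
  then show ?lower
    using set_integral_mono_set_lborel[OF compact compact_cball _ g(1,2)] eq by simp
qed

text \<open>
  Up to boundary effects of relative order \<open>1 / r\<close>, the mean over a ball of radius \<open>r\<close> equals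
  the mean over the cell; both means are multiplied out, so that no volume is a denominator.
\<close>
lemma set_integral_cball_compare_cell:
  fixes g :: "real ^ 'n \<Rightarrow> real" and \<Lambda> :: "(real ^ 'n) set"
  assumes L: "full_rank_lattice \<Lambda>" and K: "0 \<le> K" "\<And>x. infdist x \<Lambda> \<le> K"
    and g: "continuous_on UNIV g" "\<And>x. 0 \<le> g x" "\<And>x v. v \<in> \<Lambda> \<Longrightarrow> g (x + v) = g x"
  defines "m \<equiv> measure lborel (voronoi_cell \<Lambda> 0)"
    and "J \<equiv> (LINT x:voronoi_cell \<Lambda> 0|lborel. g x)"
    and "\<omega> \<equiv> unit_ball_vol (real CARD('n))"
  shows "0 \<le> r \<Longrightarrow> m * (LINT x:cball c r|lborel. g x) \<le> J * (\<omega> * (r + 2 * K) ^ CARD('n))"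
    and "2 * K \<le> r \<Longrightarrow> J * (\<omega> * (r - 2 * K) ^ CARD('n)) \<le> m * (LINT x:cball c r|lborel. g x)"
proof -
  have vol: "(LINT x:S|lborel. 1) = measure lborel S" if "compact S" for S :: "(real ^ 'n) set"
    using that by (simp add: set_lebesgue_integral_def)
  have m0: "0 \<le> m"
    by (simp add: m_def)
  have J0: "0 \<le> J"
    unfolding J_def set_lebesgue_integral_def using g(2) by (intro integral_nonneg_AE) auto
  \<comment> \<open>With the integrand 1, the bounds compare the number of lattice points in a ball,
    times \<open>m\<close>, with ball volumes.\<close>
  note one = set_integral_cball_voronoi_bounds[OF L K(2), of "\<lambda>_. 1", simplified,
      unfolded vol[OF compact_cball] vol[OF compact_voronoi_cell[OF L]], folded m_def]
  note gg = set_integral_cball_voronoi_bounds[OF L K(2) g, folded J_def]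
  {
    assume r: "0 \<le> r"
    \<comment> \<open>The unknown count is eliminated: \<open>?N * J\<close> bounds the integral
      from above, while \<open>?N * m\<close> is at most the volume of a slightly larger ball. Each
      comparison changes the radius by \<open>K\<close>, hence \<open>2 * K\<close> in
      total.\<close>
    let ?N = "real (card (\<Lambda> \<inter> cball c (r + K)))"
    have "m * (LINT x:cball c r|lborel. g x) \<le> m * (?N * J)"
      using gg(1)[of c "r + K"] m0 by (intro mult_left_mono) auto
    also have "\<dots> = J * (?N * m)"
      by simp
    also have "\<dots> \<le> J * measure lborel (cball c (r + 2 * K))"
      using one(2)[of c "r + K"] J0 by (intro mult_left_mono) (auto simp: algebra_simps)
    also have "\<dots> = J * (\<omega> * (r + 2 * K) ^ CARD('n))"
      using r K(1) content_cball[of "r + 2 * K" c] by (simp add: \<omega>_def)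
    finally show "m * (LINT x:cball c r|lborel. g x) \<le> J * (\<omega> * (r + 2 * K) ^ CARD('n))" .
  next
    assume r: "2 * K \<le> r"
    \<comment> \<open>The same elimination from below; \<open>2 * K \<le> r\<close> keeps the inner
      radius nonnegative for the volume formula.\<close>
    let ?N = "real (card (\<Lambda> \<inter> cball c (r - K)))"
    have "J * (\<omega> * (r - 2 * K) ^ CARD('n)) = J * measure lborel (cball c (r - 2 * K))"
      using r content_cball[of "r - 2 * K" c] by (simp add: \<omega>_def)
    also have "\<dots> \<le> J * (?N * m)"
      using one(1)[of c "r - K"] J0 by (intro mult_left_mono) (auto simp: algebra_simps)
    also have "\<dots> = m * (?N * J)"
      by simp
    also have "\<dots> \<le> m * (LINT x:cball c r|lborel. g x)"
      using gg(2)[of c "r - K"] m0 by (intro mult_left_mono) auto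
    finally show "J * (\<omega> * (r - 2 * K) ^ CARD('n)) \<le> m * (LINT x:cball c r|lborel. g x)" .
  }
qed

section \<open>The parallelogram inequality and its average\<close>

lemma infdist_lattice_parallelogram:
  fixes \<Lambda> :: "(real ^ 'n) set"
  assumes L: "full_rank_lattice \<Lambda>"
  shows "(infdist (w + 2 *\<^sub>R x) \<Lambda>)\<^sup>2 + (infdist w \<Lambda>)\<^sup>2
    \<le> 2 * ((infdist x \<Lambda>)\<^sup>2 + (infdist (w + x) \<Lambda>)\<^sup>2)"
proof -
  obtain p where p: "p \<in> \<Lambda>" "infdist x \<Lambda> = norm (x - p)"
    using lattice_nearest_point[OF L] .
  obtain q where q: "q \<in> \<Lambda>" "infdist (w + x) \<Lambda> = norm (w + x - q)"
    using lattice_nearest_point[OF L] .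
  let ?a = "x - p" and ?b = "w + x - q"
  \<comment> \<open>The sum \<open>?a + ?b\<close> is the offset of \<open>w + 2x\<close> from the
    lattice point \<open>p + q\<close>. Likewise \<open>?b - ?a\<close> is the offset of
    \<open>w\<close> from \<open>q - p\<close>, which handles the difference below.\<close>
  have "infdist (w + 2 *\<^sub>R x) \<Lambda> \<le> norm (w + 2 *\<^sub>R x - (p + q))"
    using p q by (intro infdist_le_norm_diff lattice_add[OF L])
  also have "w + 2 *\<^sub>R x - (p + q) = ?a + ?b"
    by (simp add: scaleR_2)
  finally have "(infdist (w + 2 *\<^sub>R x) \<Lambda>)\<^sup>2 \<le> (norm (?a + ?b))\<^sup>2"
    by (simp add: infdist_nonneg power_mono)
  moreover have "infdist w \<Lambda> \<le> norm (w - (q - p))"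
    using p q by (intro infdist_le_norm_diff lattice_diff[OF L])
  then have "infdist w \<Lambda> \<le> norm (?a - ?b)"
    by (simp add: norm_minus_commute algebra_simps)
  then have "(infdist w \<Lambda>)\<^sup>2 \<le> (norm (?a - ?b))\<^sup>2"
    by (simp add: infdist_nonneg power_mono)
  moreover have "(norm (a + b))\<^sup>2 + (norm (a - b))\<^sup>2 = 2 * ((norm a)\<^sup>2 + (norm b)\<^sup>2)" for a b :: "real ^ 'n"
    by (simp add: power2_norm_eq_inner inner_add inner_diff)
  note this[of ?a ?b]
  ultimately show ?thesis
    using p(2) q(2) by simp
qed

text \<open>Integrated over the ball of radius \<open>r\<close> about 0, the parallelogram
  inequality relates integrals of \<open>f\<close> over balls about 0 and \<open>w\<close> of radius
  \<open>r\<close> or \<open>2 * r\<close> to \<open>f w\<close> times a ball volume. Comparing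
  these integrals with the cell and letting \<open>r\<close> grow leaves
  \<open>J + f w * m \<le> 4 * J\<close>.\<close>

lemma infdist_sq_le_second_moment:
  fixes \<Lambda> :: "(real ^ 'n) set"
  assumes L: "full_rank_lattice \<Lambda>"
  shows "(infdist w \<Lambda>)\<^sup>2 * measure lborel (voronoi_cell \<Lambda> 0)
    \<le> 3 * (LINT x:voronoi_cell \<Lambda> 0|lborel. (infdist x \<Lambda>)\<^sup>2)"
proof -
  define f where "f x = (infdist x \<Lambda>)\<^sup>2" for x
  define m where "m = measure lborel (voronoi_cell \<Lambda> 0)"
  define J where "J = (LINT x:voronoi_cell \<Lambda> 0|lborel. f x)"
  define I where "I c r = (LINT x:cball c r|lborel. f x)" for c r
  define \<omega> where "\<omega> = unit_ball_vol (real CARD('n))"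
  let ?n = "CARD('n)"
  obtain K where K: "0 \<le> K" "\<And>x. infdist x \<Lambda> \<le> K"
    using infdist_lattice_bounded[OF L] by blast
  have f: "continuous_on UNIV f" "\<And>x. 0 \<le> f x" "\<And>x v. v \<in> \<Lambda> \<Longrightarrow> f (x + v) = f x"
    by (auto simp: f_def[abs_def] infdist_add_lattice[OF L] intro!: continuous_intros)
  have [measurable]: "f \<in> borel_measurable borel"
    using f(1) by (rule borel_measurable_continuous_onI)
  note compare = set_integral_cball_compare_cell[OF L K f, folded m_def J_def \<omega>_def I_def]
  have \<omega>: "\<omega> > 0"
    by (simp add: \<omega>_def)
  have m0: "m \<ge> 0"
    by (simp add: m_def)
  have int: "set_integrable lborel (cball 0 r) (\<lambda>x. f (w + a *\<^sub>R x))" for r a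
    by (intro set_integrable_lborel_compact compact_cball continuous_on_compose2[OF f(1)]
        continuous_intros) auto
  \<comment> \<open>The divisor \<open>2 ^ ?n\<close> is the Jacobian of
    \<open>x \<mapsto> w + 2x\<close>, which carries the ball of radius \<open>r\<close> about 0 to
    that of radius \<open>2 * r\<close> about \<open>w\<close>.\<close>
  have ineq: "I w (2 * r) / 2 ^ ?n + f w * (\<omega> * r ^ ?n) \<le> 2 * (I 0 r + I w r)"
    if r: "r > 0" for r
  proof -
    have 1: "I w r = (LINT x:cball 0 r|lborel. f (w + x))"
      unfolding I_def using set_lborel_integral_affine[of 1 f "cball w r" w]
      by (simp add: dist_norm cball_def)
    have "{x. w + 2 *\<^sub>R x \<in> cball w (2 * r)} = cball 0 r"
      by (auto simp: dist_norm)
    then have 2: "I w (2 * r) = 2 ^ ?n * (LINT x:cball 0 r|lborel. f (w + 2 *\<^sub>R x))"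
      unfolding I_def using set_lborel_integral_affine[of 2 f "cball w (2 * r)" w] by simp
    have 3: "(LINT x:cball (0 :: real ^ 'n) r|lborel. f w) = f w * (\<omega> * r ^ ?n)"
      using content_cball[of r "0 :: real ^ 'n"] r
      by (simp add: set_lebesgue_integral_def \<omega>_def)
    have c: "set_integrable lborel (cball 0 r) (\<lambda>x::real^'n. f w)"
      by (intro set_integrable_lborel_compact) auto
    have "(LINT x:cball 0 r|lborel. f (w + 2 *\<^sub>R x)) + f w * (\<omega> * r ^ ?n)
        = (LINT x:cball 0 r|lborel. f (w + 2 *\<^sub>R x) + f w)"
      using set_integral_add(2)[OF int c] 3 by simp
    also have "\<dots> \<le> (LINT x:cball 0 r|lborel. 2 * (f x + f (w + x)))"
      using int[of r 1] set_integrable_lborel_compact[OF compact_cball f(1), of 0 r]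
        infdist_lattice_parallelogram[OF L, of w, folded f_def]
      by (intro set_integral_mono set_integral_add(1)[OF int c] set_integrable_mult_right
          set_integral_add(1)) auto
    also have "\<dots> = 2 * (I 0 r + I w r)"
      using int[of r 1] set_integrable_lborel_compact[OF compact_cball f(1), of 0 r]
      unfolding 1 by (simp add: I_def set_integral_add(2))
    finally show ?thesis
      using 2 by simp
  qed
  \<comment> \<open>With \<open>t = 1 / r\<close> and the ball volume
    \<open>\<omega> * r ^ ?n\<close> divided out, both sides are polynomials in \<open>t\<close>.
    The condition \<open>K * t \<le> 1\<close> means \<open>2 * K \<le> 2 * r\<close>, as the lower
    comparison on the ball of radius \<open>2 * r\<close> requires.\<close>
  have bound: "J * (1 - K * t) ^ ?n + f w * m \<le> 4 * J * (1 + 2 * K * t) ^ ?n"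
    if t: "t > 0" "K * t \<le> 1" for t
  proof -
    define r where "r = 1 / t"
    have r: "r > 0" "K \<le> r"
      using t by (auto simp: r_def field_simps)
    have "m * I w (2 * r) / 2 ^ ?n + f w * m * (\<omega> * r ^ ?n) \<le> 2 * (m * I 0 r + m * I w r)"
      using mult_left_mono[OF ineq[OF r(1)] m0] by (simp add: algebra_simps)
    also have "\<dots> \<le> 2 * (J * (\<omega> * (r + 2 * K) ^ ?n) + J * (\<omega> * (r + 2 * K) ^ ?n))"
      using r by (intro mult_left_mono add_mono compare(1)) auto
    also have "\<dots> = (4 * J * (1 + 2 * K * t) ^ ?n) * (\<omega> * r ^ ?n)"
    proof -
      have "r + 2 * K = (1 + 2 * K * t) * r"
        using t by (simp add: r_def field_simps)
      then show ?thesis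
        by (simp add: power_mult_distrib)
    qed
    finally have up: "m * I w (2 * r) / 2 ^ ?n + f w * m * (\<omega> * r ^ ?n)
      \<le> (4 * J * (1 + 2 * K * t) ^ ?n) * (\<omega> * r ^ ?n)" .
    \<comment> \<open>The factor \<open>2 ^ ?n\<close> from the volume of the doubled ball cancels
      the Jacobian, so doubling preserves the leading term.\<close>
    have "(J * (1 - K * t) ^ ?n) * (\<omega> * r ^ ?n) = J * (\<omega> * (2 * r - 2 * K) ^ ?n) / 2 ^ ?n"
    proof -
      have "2 * r - 2 * K = 2 * ((1 - K * t) * r)"
        using t by (simp add: r_def field_simps)
      then have "(2 * r - 2 * K) ^ ?n = 2 ^ ?n * ((1 - K * t) ^ ?n * r ^ ?n)"
        by (simp only: power_mult_distrib)
      then show ?thesis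
        by simp
    qed
    also have "\<dots> \<le> m * I w (2 * r) / 2 ^ ?n"
      using r by (intro divide_right_mono compare(2)) auto
    finally have "(J * (1 - K * t) ^ ?n + f w * m) * (\<omega> * r ^ ?n)
      \<le> (4 * J * (1 + 2 * K * t) ^ ?n) * (\<omega> * r ^ ?n)"
      using up by (simp add: distrib_right)
    then show ?thesis
      using \<omega> r by (simp add: mult_le_cancel_right)
  qed
  \<comment> \<open>The limit of infinite radius is taken as \<open>t\<close> tends to 0 from the
    right, which removes the boundary terms in \<open>K\<close>.\<close>
  have "eventually (\<lambda>t. J * (1 - K * t) ^ ?n + f w * m \<le> 4 * J * (1 + 2 * K * t) ^ ?n) (at_right 0)"
  proof -
    have "((\<lambda>t. K * t) \<longlongrightarrow> K * 0) (at_right 0)"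
      by (intro tendsto_intros)
    then have "eventually (\<lambda>t. K * t < 1) (at_right 0)"
      by (rule order_tendstoD) simp
    moreover have "eventually (\<lambda>t::real. t > 0) (at_right 0)"
      by (rule eventually_at_right_less)
    ultimately show ?thesis
      by eventually_elim (simp add: bound)
  qed
  moreover have "((\<lambda>t. 4 * J * (1 + 2 * K * t) ^ ?n) \<longlongrightarrow> 4 * J * (1 + 2 * K * 0) ^ ?n) (at_right 0)"
    by (intro tendsto_intros)
  moreover have "((\<lambda>t. J * (1 - K * t) ^ ?n + f w * m) \<longlongrightarrow> J * (1 - K * 0) ^ ?n + f w * m) (at_right 0)"
    by (intro tendsto_intros)
  ultimately have "J * (1 - K * 0) ^ ?n + f w * m \<le> 4 * J * (1 + 2 * K * 0) ^ ?n"
    by (intro tendsto_le[OF trivial_limit_at_right_real])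
  then show ?thesis
    by (simp add: f_def J_def m_def)
qed

section \<open>From the pointwise bound to the covering radius\<close>

theorem theorem1:
  fixes \<Lambda> P :: "(real ^ 'n) set" and R :: real
  assumes "full_rank_lattice \<Lambda>"
    and "P = voronoi_cell \<Lambda> 0"
    and "R = covering_radius \<Lambda>"
  shows "(LINT x:P|lebesgue. (norm x)\<^sup>2) \<ge> R\<^sup>2 / 3 * measure lebesgue P"
proof -
  note L = assms(1)
  have P: "P \<in> sets borel"
    using compact_imp_closed[OF compact_voronoi_cell[OF L]] assms(2) by (simp add: borel_closed)
  define J where "J = (LINT x:P|lborel. (norm x)\<^sup>2)"
  define m where "m = measure lborel P"
  \<comment> \<open>Set and integrand are Borel, so completing the measure does not change the
    integral.\<close>
  have leb: "(LINT x:P|lebesgue. (norm x)\<^sup>2) = J"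
    unfolding J_def set_lebesgue_integral_def using P by (intro integral_completion) auto
  \<comment> \<open>On the cell of 0, the norm is the distance to the lattice.\<close>
  have "J = (LINT x:P|lborel. (infdist x \<Lambda>)\<^sup>2)"
    unfolding J_def using P assms(2) by (intro set_lebesgue_integral_cong) (auto simp: voronoi_cell_def)
  then have bound: "(infdist w \<Lambda>)\<^sup>2 * m \<le> 3 * J" for w
    using infdist_sq_le_second_moment[OF L, of w] assms(2) by (simp add: m_def)
  have "R\<^sup>2 * m \<le> 3 * J"
  \<comment> \<open>Passing to the supremum involves division by \<open>m\<close>. For
    \<open>m = 0\<close> the claim reduces to \<open>0 \<le> 3 * J\<close>, which any instance of
    \<open>bound\<close> gives.\<close>
  proof (cases "m = 0")
    case True
    then show ?thesis
      using bound[of 0] by simp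
  next
    case False
    then have m: "m > 0"
      by (simp add: m_def zero_less_measure_iff)
    have "infdist w \<Lambda> \<le> sqrt (3 * J / m)" for w
      using bound[of w] m by (intro real_le_rsqrt) (simp add: field_simps)
    then have "R \<le> sqrt (3 * J / m)"
      unfolding assms(3) covering_radius_def by (intro cSUP_least) auto
    \<comment> \<open>Squaring \<open>R \<le> sqrt (3 * J / m)\<close> requires
      \<open>0 \<le> R\<close>. Boundedness of the distance makes the real supremum a genuine upper
      bound, so \<open>R\<close> dominates a nonnegative value.\<close>
    moreover have "0 \<le> R"
    proof -
      obtain K where "\<And>x. infdist x \<Lambda> \<le> K"
        using infdist_lattice_bounded[OF L] by blast
      then have "infdist 0 \<Lambda> \<le> R"
        unfolding assms(3) covering_radius_def by (intro cSUP_upper bdd_aboveI2[of _ _ K]) auto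
      then show ?thesis
        using infdist_nonneg[of 0 \<Lambda>] by linarith
    qed
    moreover have "0 \<le> 3 * J / m"
      using m bound[of 0] order_trans[of 0 "(infdist 0 \<Lambda>)\<^sup>2 * m" "3 * J"] by simp
    ultimately have "R\<^sup>2 \<le> 3 * J / m"
      using power_mono[of R "sqrt (3 * J / m)" 2] by simp
    then show ?thesis
      using m by (simp add: field_simps)
  qed
  moreover have "measure lebesgue P = m"
    using P by (simp add: m_def)
  ultimately show ?thesis
    unfolding leb by simp
qed

end
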